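(* Let $s=\{s_m\}_{m=0}^\infty$ be a determinate Hamburger moment sequence such that its unique representing measure $\mu$ has infinite support and $\mu(\{0\})=0$, and let $t=\{t_n\}_{n=0}^\infty$ be an indeterminate Hamburger moment sequence. Then the sequence $s\otimes t=\{(s\otimes t)_{m,n}\}_{m,n=0}^\infty$ defined by $(s\otimes t)_{m,n}=s_mt_n$ for $m,n\ge 0$ is a two-dimensional Hamburger moment sequence such that: $1^\circ$ it is indeterminate; $2^\circ$ none of its representing measures has an atom at $0=(0,0)$; $3^\circ$ all its representing measures have (closed) supports dense in $\mathbb R^2$ with respect to the Zariski topology.
   Context: All measures are positive, and integrands are tacitly assumed to be absolutely integrable wherever integrals appear. "Support" means closed support. Convention: $0^0=1$. A sequence $s=\{s_n\}_{n=0}^\infty\subset\mathbb R$ is a Hamburger moment sequence if there is a Borel measure $\tau$ on $\mathbb R$ (a representing measure for $s$) with $s_n=\int_{\mathbb R}x^n\,d\tau(x)$ for all $n\ge 0$; it is determinate if $\tau$ is unique and indeterminate otherwise. A sequence $a=\{a_{m,n}\}_{m,n=0}^\infty\subset\mathbb R$ is a two-dimensional Hamburger moment sequence if there is a Borel measure $\varrho$ on $\mathbb R^2$ (a representing measure for $a$) with $a_{m,n}=\int_{\mathbb R^2}x^my^n\,d\varrho(x,y)$ for all $m,n\ge 0$; it is determinate if $\varrho$ is unique and indeterminate otherwise. The Zariski topology on $\mathbb R^2$ is the one whose closed sets are the sets $\{(x,y)\in\mathbb R^2:q(x,y)=0\}$ with $q\in\mathbb C[x,y]$. *)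

theory Defs
  imports "HOL-Analysis.Analysis" "HOL-Computational_Algebra.Polynomial"
begin

text \<open>The integrability clauses are the tacit absolute integrability of the integrands; for
  exponent zero they say that the measure is finite.\<close>

definition represents :: "real measure \<Rightarrow> (nat \<Rightarrow> real) \<Rightarrow> bool" where
  "represents \<tau> s \<longleftrightarrow> sets \<tau> = sets borel \<and>
     (\<forall>n. integrable \<tau> (\<lambda>x. x ^ n) \<and> s n = (\<integral>x. x ^ n \<partial>\<tau>))"

definition hamburger :: "(nat \<Rightarrow> real) \<Rightarrow> bool" where
  "hamburger s \<longleftrightarrow> (\<exists>\<tau>. represents \<tau> s)"

definition determinate :: "(nat \<Rightarrow> real) \<Rightarrow> bool" where
  "determinate s \<longleftrightarrow> (\<exists>!\<tau>. represents \<tau> s)"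

definition indeterminate :: "(nat \<Rightarrow> real) \<Rightarrow> bool" where
  "indeterminate s \<longleftrightarrow> hamburger s \<and> \<not> determinate s"

definition represents2 :: "(real \<times> real) measure \<Rightarrow> (nat \<Rightarrow> nat \<Rightarrow> real) \<Rightarrow> bool" where
  "represents2 \<rho> a \<longleftrightarrow> sets \<rho> = sets borel \<and>
     (\<forall>m n. integrable \<rho> (\<lambda>(x, y). x ^ m * y ^ n) \<and> a m n = (\<integral>(x, y). x ^ m * y ^ n \<partial>\<rho>))"

definition hamburger2 :: "(nat \<Rightarrow> nat \<Rightarrow> real) \<Rightarrow> bool" where
  "hamburger2 a \<longleftrightarrow> (\<exists>\<rho>. represents2 \<rho> a)"

definition determinate2 :: "(nat \<Rightarrow> nat \<Rightarrow> real) \<Rightarrow> bool" where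
  "determinate2 a \<longleftrightarrow> (\<exists>!\<rho>. represents2 \<rho> a)"

definition indeterminate2 :: "(nat \<Rightarrow> nat \<Rightarrow> real) \<Rightarrow> bool" where
  "indeterminate2 a \<longleftrightarrow> hamburger2 a \<and> \<not> determinate2 a"

definition seq_tensor :: "(nat \<Rightarrow> real) \<Rightarrow> (nat \<Rightarrow> real) \<Rightarrow> nat \<Rightarrow> nat \<Rightarrow> real" where
  "seq_tensor s t = (\<lambda>m n. s m * t n)"

definition closed_support :: "'a::topological_space measure \<Rightarrow> 'a set" where
  "closed_support M = {x. \<forall>U. open U \<longrightarrow> x \<in> U \<longrightarrow> emeasure M U > 0}"

text \<open>A polynomial in \<open>\<complex>[x, y]\<close> is represented as an element of \<open>\<complex>[x][y]\<close>: the outer variable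
  is \<open>y\<close>, and the coefficients are polynomials in \<open>x\<close>.\<close>

definition eval2 :: "complex poly poly \<Rightarrow> real \<times> real \<Rightarrow> complex" where
  "eval2 q = (\<lambda>(x, y). poly (poly q [:of_real y:]) (of_real x))"

definition zero_locus :: "complex poly poly \<Rightarrow> (real \<times> real) set" where
  "zero_locus q = {z. eval2 q z = 0}"

definition zariski :: "(real \<times> real) topology" where
  "zariski = topology (\<lambda>U. \<exists>q. U = - zero_locus q)"

text \<open>The rest of the theory shows that the complements of the zero loci do form a topology, so that
  \<open>zariski\<close> is not an unspecified value of \<open>topology\<close>.  Arbitrary intersections of zero loci
  are handled by the argument of Hilbert's basis theorem over the principal ideal domain \<open>\<complex>[x]\<close>.\<close>

lemma eval2_simps:
  "eval2 0 z = 0" "eval2 1 z = 1"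
  "eval2 (p + q) z = eval2 p z + eval2 q z"
  "eval2 (p - q) z = eval2 p z - eval2 q z"
  "eval2 (p * q) z = eval2 p z * eval2 q z"
  by (auto simp: eval2_def split: prod.splits)

lemma eval2_sum: "eval2 (sum f A) z = (\<Sum>i\<in>A. eval2 (f i) z)"
  by (induction A rule: infinite_finite_induct) (auto simp: eval2_simps)

lemma poly_cnj_coeffs: "poly (map_poly cnj p) (of_real x) = cnj (poly p (of_real x))"
  by (induction p) (auto simp: map_poly_pCons)

lemma eval2_cnj_coeffs: "eval2 (map_poly (map_poly cnj) q) z = cnj (eval2 q z)"
proof (cases z)
  case (Pair x y)
  have "poly (poly (map_poly (map_poly cnj) q) [:of_real y:]) (of_real x) =
        cnj (poly (poly q [:of_real y:]) (of_real x))"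
    by (induction q) (auto simp: map_poly_pCons poly_cnj_coeffs)
  then show ?thesis by (simp add: Pair eval2_def)
qed

lemma zero_locus_Int_finite:
  fixes P :: "nat \<Rightarrow> complex poly poly"
  shows "\<exists>q. zero_locus q = (\<Inter>i\<le>N. zero_locus (P i))"
proof -
  define q where "q = (\<Sum>i\<le>N. P i * map_poly (map_poly cnj) (P i))"
  have "eval2 q z = of_real (\<Sum>i\<le>N. (cmod (eval2 (P i) z))\<^sup>2)" for z
    unfolding q_def eval2_sum
    by (simp add: eval2_simps eval2_cnj_coeffs complex_norm_square del: of_real_power)
  then have "eval2 q z = 0 \<longleftrightarrow> (\<forall>i\<le>N. eval2 (P i) z = 0)" for z
    by (auto simp add: sum_nonneg_eq_0_iff simp del: of_real_sum of_real_power)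
  then have "zero_locus q = (\<Inter>i\<le>N. zero_locus (P i))"
    by (auto simp: zero_locus_def)
  then show ?thesis ..
qed

lemma principal_ideal:
  fixes J :: "complex poly set"
  assumes "0 \<in> J" and diff: "\<And>a b. a \<in> J \<Longrightarrow> b \<in> J \<Longrightarrow> a - b \<in> J"
    and mult: "\<And>a c. a \<in> J \<Longrightarrow> c * a \<in> J"
  obtains g where "g \<in> J" "\<And>a. a \<in> J \<Longrightarrow> g dvd a"
proof (cases "J \<subseteq> {0}")
  case True
  with \<open>0 \<in> J\<close> that[of 0] show ?thesis by auto
next
  case False
  then obtain b where "b \<in> J \<and> b \<noteq> 0" by auto
  then obtain g where g: "g \<in> J" "g \<noteq> 0" and least: "\<And>a. a \<in> J \<and> a \<noteq> 0 \<Longrightarrow> degree g \<le> degree a"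
    using ex_has_least_nat[of "\<lambda>a. a \<in> J \<and> a \<noteq> 0" b degree] by blast
  have "g dvd a" if "a \<in> J" for a
  proof -
    have "a mod g \<in> J"
      using diff[OF that mult[OF g(1), of "a div g"]] by (simp add: minus_div_mult_eq_mod)
    then have "a mod g = 0"
      using least[of "a mod g"] degree_mod_less[OF g(2), of a] by force
    then show ?thesis by auto
  qed
  with g(1) that show ?thesis by blast
qed

lemma zero_locus_Inter: "\<exists>q. zero_locus q = (\<Inter>f\<in>F. zero_locus f)"
proof -
  define C where "C = (\<Inter>f\<in>F. zero_locus f)"
  define I where "I = {p. \<forall>z\<in>C. eval2 p z = 0}"
  have I0: "0 \<in> I" and Idiff: "\<And>p q. p \<in> I \<Longrightarrow> q \<in> I \<Longrightarrow> p - q \<in> I"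
    and Imult: "\<And>p q. p \<in> I \<Longrightarrow> q * p \<in> I"
    by (auto simp: I_def eval2_simps)
  define L where "L n = {coeff p n |p. p \<in> I \<and> degree p \<le> n}" for n
  have L0: "0 \<in> L n" for n
    unfolding L_def using I0 by (auto intro!: exI[of _ 0])
  have Ldiff: "a - b \<in> L n" if ab: "a \<in> L n" "b \<in> L n" for a b n
  proof -
    obtain p q where "a = coeff p n" "p \<in> I" "degree p \<le> n" "b = coeff q n" "q \<in> I" "degree q \<le> n"
      using ab by (auto simp: L_def)
    then show ?thesis
      unfolding L_def by (auto intro!: exI[of _ "p - q"] Idiff degree_diff_le)
  qed
  have Lmult: "c * a \<in> L n" if a: "a \<in> L n" for a c n
  proof -
    obtain p where "a = coeff p n" "p \<in> I" "degree p \<le> n"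
      using a by (auto simp: L_def)
    then show ?thesis
      unfolding L_def using Imult[of p "[:c:]"] order.trans[OF degree_smult_le[of c p]]
      by (auto intro!: exI[of _ "smult c p"])
  qed
  have Lshift: "a \<in> L (n + k)" if a: "a \<in> L n" for a n k
  proof -
    obtain p where "a = coeff p n" "p \<in> I" "degree p \<le> n"
      using a by (auto simp: L_def)
    then show ?thesis
      unfolding L_def using Imult[of p "monom 1 k"]
      by (auto intro!: exI[of _ "monom 1 k * p"] order.trans[OF degree_mult_le] add_mono
               simp: coeff_monom_mult degree_monom_eq add.commute)
  qed
  then have Lmono: "L m \<subseteq> L n" if "m \<le> n" for m n
    using that by (metis le_add_diff_inverse subsetI)
  have "\<exists>g. g \<in> L n \<and> (\<forall>a\<in>L n. g dvd a)" for n
    by (rule principal_ideal[OF L0 Ldiff Lmult]) auto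
  then obtain G where G: "\<And>n. G n \<in> L n" "\<And>n a. a \<in> L n \<Longrightarrow> G n dvd a"
    by metis
  have Udiff: "a - b \<in> (\<Union>n. L n)" if ab: "a \<in> (\<Union>n. L n)" "b \<in> (\<Union>n. L n)" for a b
  proof -
    obtain m n where "a \<in> L m" "b \<in> L n" using ab by auto
    then have "a \<in> L (max m n)" "b \<in> L (max m n)"
      using Lmono[of m "max m n"] Lmono[of n "max m n"] by auto
    then show ?thesis using Ldiff by blast
  qed
  have U0: "0 \<in> (\<Union>n. L n)" using L0 by blast
  have Umult: "c * a \<in> (\<Union>n. L n)" if "a \<in> (\<Union>n. L n)" for a c
    using that Lmult by blast
  have "\<exists>g. g \<in> (\<Union>n. L n) \<and> (\<forall>a\<in>(\<Union>n. L n). g dvd a)"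
    by (rule principal_ideal[OF U0 Udiff Umult]) auto
  then obtain g N where N: "g \<in> L N" and g: "\<And>n a. a \<in> L n \<Longrightarrow> g dvd a" by blast
  have GN: "G N dvd a" if "a \<in> L n" for a n
    using G(2)[OF N] g[OF that] by (auto intro: dvd_trans)
  have "\<exists>p. p \<in> I \<and> degree p \<le> n \<and> coeff p n = G n" for n
    using G(1)[of n] unfolding L_def by force
  then obtain P where P: "\<And>n. P n \<in> I" "\<And>n. degree (P n) \<le> n" "\<And>n. coeff (P n) n = G n"
    by metis
  have vanish: "eval2 p z = 0" if z: "\<And>i. i \<le> N \<Longrightarrow> eval2 (P i) z = 0" and "p \<in> I" for p z
    using \<open>p \<in> I\<close>
  proof (induction "degree p" arbitrary: p rule: less_induct)
    case less
    define n where "n = degree p"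
    define k where "k = min n N"
    have pL: "coeff p n \<in> L n" using less.prems by (auto simp: L_def n_def)
    have "G k dvd coeff p n"
      using GN[OF pL] G(2)[OF pL] by (auto simp: k_def min_def)
    then obtain h where h: "coeff p n = G k * h" by (elim dvdE)
    define r where "r = monom h (n - k) * P k"
    have kn: "k \<le> n" by (simp add: k_def)
    have r: "r \<in> I" "eval2 r z = 0"
      using z[of k] P(1) by (auto simp: r_def k_def eval2_simps intro: Imult)
    have rn: "coeff r n = coeff p n"
      using kn unfolding r_def coeff_monom_mult h by (simp add: P(3))
    have "degree r \<le> (n - k) + k"
      unfolding r_def by (intro order.trans[OF degree_mult_le] add_mono degree_monom_le P(2))
    then have "degree r \<le> n" using kn by simp
    then have dle: "degree (p - r) \<le> n" by (intro degree_diff_le) (auto simp: n_def)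
    have c0: "coeff (p - r) n = 0" using rn by simp
    have "eval2 (p - r) z = 0"
    proof (cases "p - r = 0")
      case False
      with dle c0 have "degree (p - r) < n"
        using leading_coeff_neq_0 order_le_less by metis
      then show ?thesis using less.hyps[of "p - r"] Idiff[OF less.prems r(1)] by (simp add: n_def)
    qed (simp add: eval2_simps)
    then show ?case using r(2) by (simp add: eval2_simps)
  qed
  have "F \<subseteq> I" by (auto simp: I_def C_def zero_locus_def)
  then have "(\<Inter>i\<le>N. zero_locus (P i)) \<subseteq> C"
    using vanish by (auto simp: C_def zero_locus_def subset_iff)
  moreover have "C \<subseteq> (\<Inter>i\<le>N. zero_locus (P i))"
    using P(1) by (auto simp: I_def zero_locus_def)
  ultimately show ?thesis
    using zero_locus_Int_finite[of P N] unfolding C_def by (metis subset_antisym)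
qed

lemma istopology_zariski: "istopology (\<lambda>U. \<exists>q. U = - zero_locus q)"
  unfolding istopology_def
proof (intro conjI allI impI)
  fix S T assume "\<exists>p. S = - zero_locus p" "\<exists>q. T = - zero_locus q"
  then obtain p q where "S = - zero_locus p" "T = - zero_locus q" by blast
  then have "S \<inter> T = - zero_locus (p * q)" by (auto simp: zero_locus_def eval2_simps)
  then show "\<exists>q. S \<inter> T = - zero_locus q" ..
next
  fix K :: "(real \<times> real) set set" assume "\<forall>U\<in>K. \<exists>q. U = - zero_locus q"
  then obtain f where f: "\<And>U. U \<in> K \<Longrightarrow> U = - zero_locus (f U)" by metis
  obtain q where "zero_locus q = (\<Inter>p\<in>f ` K. zero_locus p)" using zero_locus_Inter by blast
  then have "\<Union>K = - zero_locus q" using f by fastforce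
  then show "\<exists>q. \<Union>K = - zero_locus q" ..
qed

lemma openin_zariski: "openin zariski U \<longleftrightarrow> (\<exists>q. U = - zero_locus q)"
  unfolding zariski_def by (simp add: topology_inverse' istopology_zariski)

lemma topspace_zariski: "topspace zariski = UNIV"
proof -
  have "openin zariski UNIV"
    unfolding openin_zariski by (rule exI[of _ 1]) (auto simp: zero_locus_def eval2_simps)
  then show ?thesis using openin_subset by blast
qed

lemma closedin_zariski: "closedin zariski C \<longleftrightarrow> (\<exists>q. C = zero_locus q)"
  by (simp add: closedin_def topspace_zariski openin_zariski flip: Compl_eq_Diff_UNIV)

end

theory Submission
  imports Defs
begin

text \<open>
  The product of a representing measure \<open>\<mu>\<close> of \<open>s\<close> and a representing measure \<open>\<tau>\<close> of \<open>t\<close>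
  represents \<open>s \<otimes> t\<close> by Fubini, and since \<open>\<mu>\<close> has positive finite mass, distinct choices of \<open>\<tau>\<close> give
  distinct products (\<open>pair_measure_cancel_left\<close>). Hence indeterminacy of \<open>t\<close> passes to
  \<open>s \<otimes> t\<close>.

  Now let \<open>\<rho>\<close> be any representing measure of \<open>s \<otimes> t\<close>. Its marginal on the first coordinate has the
  moments \<open>s\<^sub>m t\<^sub>0\<close>, so determinacy of \<open>s\<close> forces this marginal to be \<open>t\<^sub>0 \<mu>\<close>
  (\<open>represents_fst_marginal\<close>). An atom of \<open>\<rho>\<close> at the origin would give \<open>\<mu>\<close> an atom at \<open>0\<close>.

  For density, let a polynomial \<open>q\<close> vanish on the support of \<open>\<rho>\<close>. The integral of \<open>\<bar>q\<bar>\<^sup>2\<close>, where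
  \<open>\<bar>q\<bar>\<^sup>2\<close> is again a polynomial on the real plane, depends only on the moments, so it is \<open>0\<close> also for
  \<open>\<mu> \<otimes> \<tau>\<close> (\<open>represents2_AE_eval2_eq_0_cong\<close>). By continuity \<open>q\<close> vanishes on
  \<open>supp \<mu> \<times> supp \<tau>\<close>. Both factors are infinite: the first by hypothesis, the second because a
  measure of finite support is determined by its moments
  (\<open>represents_unique_if_finite_support\<close>). A polynomial vanishing on a product of two infinite
  sets is \<open>0\<close>, so the Zariski closure of the support is the whole plane.
\<close>

section \<open>Supports\<close>

text \<open>Each point outside the support has a null neighbourhood; by the Lindelof property countably many
  of these suffice to cover the complement.\<close>

lemma null_set_outside_closed_support:
  fixes M :: "'a::second_countable_topology measure"
  assumes sets: "sets M = sets borel" and "open U" "U \<inter> closed_support M = {}"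
  shows "U \<in> null_sets M"
proof -
  let ?\<N> = "{V. open V \<and> emeasure M V = 0}"
  obtain \<V> where \<V>: "\<V> \<subseteq> ?\<N>" "countable \<V>" "\<Union>\<V> = \<Union>?\<N>"
    using Lindelof[of ?\<N>] by blast
  have "\<Union>?\<N> \<in> null_sets M"
    unfolding \<V>(3)[symmetric] using null_sets_UN'[OF \<V>(2), of "\<lambda>V. V" M] \<V>(1)
    by (force simp: sets null_sets_def)
  moreover have "U \<subseteq> \<Union>?\<N>"
  proof
    fix x assume "x \<in> U"
    with assms(3) have "x \<notin> closed_support M" by auto
    then obtain V where "open V" "x \<in> V" "emeasure M V = 0"
      by (auto simp: closed_support_def not_gr_zero)
    then show "x \<in> \<Union>?\<N>" by auto
  qed
  moreover have "U \<in> sets M" using \<open>open U\<close> by (simp add: sets)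
  ultimately show ?thesis by (blast intro: null_sets_subset)
qed

lemma closed_closed_support: "closed (closed_support M)"
proof -
  have "- closed_support M = \<Union>{V. open V \<and> \<not> emeasure M V > 0}"
    by (auto simp: closed_support_def)
  then show ?thesis
    by (metis (no_types, lifting) closed_def mem_Collect_eq open_Union)
qed

lemma AE_in_closed_support:
  fixes M :: "'a::second_countable_topology measure"
  assumes "sets M = sets borel"
  shows "AE x in M. x \<in> closed_support M"
proof (rule AE_I')
  show "- closed_support M \<in> null_sets M"
    by (rule null_set_outside_closed_support[OF assms]) (auto simp: closed_closed_support)
qed auto

lemma sets_pair_measure_borel:
  fixes M :: "'a::second_countable_topology measure" and N :: "'b::second_countable_topology measure"
  assumes "sets M = sets borel" "sets N = sets borel"
  shows "sets (M \<Otimes>\<^sub>M N) = sets borel"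
  using sets_pair_measure_cong[OF assms] unfolding borel_prod .

lemma closed_support_times_subset:
  fixes M :: "'a::second_countable_topology measure" and N :: "'b::second_countable_topology measure"
  assumes "sets M = sets borel" "sets N = sets borel" "sigma_finite_measure N"
  shows "closed_support M \<times> closed_support N \<subseteq> closed_support (M \<Otimes>\<^sub>M N)"
proof clarify
  fix x y assume x: "x \<in> closed_support M" and y: "y \<in> closed_support N"
  show "(x, y) \<in> closed_support (M \<Otimes>\<^sub>M N)"
    unfolding closed_support_def
  proof (intro CollectI allI impI)
    fix U :: "('a \<times> 'b) set" assume U: "open U" "(x, y) \<in> U"
 from U obtain A B where AB: "open A" "open B" "x \<in> A" "y \<in> B" "A \<times> B \<subseteq> U"
      by (rule open_prod_elim) auto
    have "0 < emeasure M A * emeasure N B"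
      using x y AB by (auto simp: closed_support_def ennreal_zero_less_mult_iff)
    also have "\<dots> = emeasure (M \<Otimes>\<^sub>M N) (A \<times> B)"
      using AB assms by (intro sigma_finite_measure.emeasure_pair_measure_Times[symmetric]) auto
    also have "\<dots> \<le> emeasure (M \<Otimes>\<^sub>M N) U"
    proof (intro emeasure_mono AB)
      show "U \<in> sets (M \<Otimes>\<^sub>M N)" using U by (simp add: sets_pair_measure_borel assms)
    qed
    finally show "0 < emeasure (M \<Otimes>\<^sub>M N) U" .
  qed
qed

section \<open>Integration of polynomials against moment sequences\<close>

lemma represents_finite_measure:
  assumes "represents \<tau> s"
  shows "finite_measure \<tau>"
proof -
  have "integrable \<tau> (\<lambda>x. 1 :: real)"
    using assms unfolding represents_def by (metis (no_types, lifting) power_0 Bochner_Integration.integrable_cong)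
  then show ?thesis by (intro finite_measureI) (auto simp: integrable_iff_bounded)
qed

lemma represents_integral_poly:
  assumes "represents \<tau> s"
  shows "integrable \<tau> (poly p)" "(\<integral>x. poly p x \<partial>\<tau>) = (\<Sum>i\<le>degree p. coeff p i * s i)"
  using assms unfolding represents_def poly_altdef[abs_def] by auto

lemma eval2_altdef:
  "eval2 q (x, y) = (\<Sum>j\<le>degree q. \<Sum>i\<le>degree (coeff q j). coeff (coeff q j) i * of_real (x ^ i * y ^ j))"
  by (simp add: eval2_def poly_altdef[of q] poly_sum poly_power poly_altdef[of "coeff q _"]
      sum_distrib_right mult.assoc)

lemma represents2_integral_eval2:
  assumes "represents2 \<rho> a"
  shows "integrable \<rho> (eval2 q)"
    "(\<integral>z. eval2 q z \<partial>\<rho>) =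
       (\<Sum>j\<le>degree q. \<Sum>i\<le>degree (coeff q j). coeff (coeff q j) i * of_real (a i j))"
proof -
  have eq: "eval2 q = (\<lambda>z. \<Sum>j\<le>degree q. \<Sum>i\<le>degree (coeff q j).
      coeff (coeff q j) i * of_real (case z of (x, y) \<Rightarrow> x ^ i * y ^ j))"
    by (auto simp: fun_eq_iff eval2_altdef simp del: of_real_mult of_real_power)
  have int: "integrable \<rho> (\<lambda>z. case z of (x, y) \<Rightarrow> x ^ i * y ^ j)"
    "(\<integral>z. (case z of (x, y) \<Rightarrow> x ^ i * y ^ j) \<partial>\<rho>) = a i j" for i j
    using assms by (auto simp: represents2_def)
  have int': "integrable \<rho> (\<lambda>z. complex_of_real (case z of (x, y) \<Rightarrow> x ^ i * y ^ j))" for i j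
    using int(1) by (rule integrable_of_real)
  have int'': "(\<integral>z. complex_of_real (case z of (x, y) \<Rightarrow> x ^ i * y ^ j) \<partial>\<rho>) = of_real (a i j)" for i j
    unfolding int(2)[symmetric] by (rule integral_complex_of_real)
  show "integrable \<rho> (eval2 q)"
    unfolding eq by (intro Bochner_Integration.integrable_sum integrable_mult_right int')
  show "(\<integral>z. eval2 q z \<partial>\<rho>) =
       (\<Sum>j\<le>degree q. \<Sum>i\<le>degree (coeff q j). coeff (coeff q j) i * of_real (a i j))"
    unfolding eq
    by (simp only: Bochner_Integration.integral_sum Bochner_Integration.integrable_sum
        integrable_mult_right int' integral_mult_right_zero int'')
qed

text \<open>Vanishing almost everywhere is detected by the integral of \<open>\<bar>q\<bar>\<^sup>2\<close>. On the real plane this is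
  the value of the polynomial \<open>q\<close> times its coefficientwise conjugate, so its integral is a linear
  combination of moments and is the same for all representing measures.\<close>

lemma represents2_AE_eval2_eq_0_cong:
  assumes \<rho>: "represents2 \<rho> a" and \<sigma>: "represents2 \<sigma> a" and "AE z in \<rho>. eval2 q z = 0"
  shows "AE z in \<sigma>. eval2 q z = 0"
proof -
  define r where "r = q * map_poly (map_poly cnj) q"
  have r: "eval2 r z = of_real ((cmod (eval2 q z))\<^sup>2)" for z
    by (simp add: r_def eval2_simps eval2_cnj_coeffs complex_norm_square del: of_real_power)
  have "integrable \<sigma> (eval2 r)" using \<sigma> by (rule represents2_integral_eval2)
  from integrable_norm[OF this] have int: "integrable \<sigma> (\<lambda>z. (cmod (eval2 q z))\<^sup>2)"
    by (simp add: r norm_power)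
  have "(\<integral>z. eval2 r z \<partial>\<sigma>) = (\<integral>z. eval2 r z \<partial>\<rho>)"
    using represents2_integral_eval2(2)[OF \<rho>] represents2_integral_eval2(2)[OF \<sigma>] by simp
  also have "\<dots> = 0"
    using assms(3) by (intro integral_eq_zero_AE) (auto simp: r)
  finally have "complex_of_real (\<integral>z. (cmod (eval2 q z))\<^sup>2 \<partial>\<sigma>) = 0"
    unfolding r by (simp only: integral_complex_of_real)
  then have "(\<integral>z. (cmod (eval2 q z))\<^sup>2 \<partial>\<sigma>) = 0" by (simp only: of_real_eq_0_iff)
  then show ?thesis
    using integral_nonneg_eq_0_iff_AE[OF int] by simp
qed

section \<open>Finitely supported measures are determinate\<close>

lemma poly_interpolation:
  fixes f :: "'a::field \<Rightarrow> 'a"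
  assumes "finite F"
  obtains p where "\<And>x. x \<in> F \<Longrightarrow> poly p x = f x"
  using assms
proof (induction F arbitrary: thesis rule: finite_induct)
  case empty
  then show ?case by simp
next
  case (insert a F)
  obtain p where p: "\<And>x. x \<in> F \<Longrightarrow> poly p x = f x" using insert.IH by blast
  define w where "w = (\<Prod>b\<in>F. [:-b, 1:])"
  have w: "poly w x = 0 \<longleftrightarrow> x \<in> F" for x
    using insert.hyps(1) by (auto simp: w_def poly_prod)
  \<comment> \<open>Correct the value at \<open>a\<close> by a multiple of \<open>w\<close>, which vanishes exactly on \<open>F\<close>.\<close>
  define r where "r = p + smult ((f a - poly p a) / poly w a) w"
  have "poly r x = f x" if "x \<in> insert a F" for x
    using that insert.hyps(2) by (auto simp: r_def p w)
  then show ?case by (rule insert.prems)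
qed

text \<open>Let \<open>\<tau>\<close> have finite support \<open>F\<close>. The polynomial \<open>\<Prod>b\<in>F. (x - b)\<^sup>2\<close> is nonnegative with
  integral \<open>0\<close>, which is a condition on the moments alone, so any other representing measure \<open>\<nu>\<close>
  is concentrated on \<open>F\<close> as well. There the indicator of any set agrees with an interpolating
  polynomial, whence \<open>\<nu>\<close> and \<open>\<tau>\<close> give that set the same measure.\<close>

lemma represents_unique_if_finite_support:
  assumes \<tau>: "represents \<tau> t" and \<nu>: "represents \<nu> t" and fin: "finite (closed_support \<tau>)"
  shows "\<nu> = \<tau>"
proof (rule measure_eqI)
  have sets: "sets \<tau> = sets borel" "sets \<nu> = sets borel"
    using \<tau> \<nu> by (auto simp: represents_def)
  then show "sets \<nu> = sets \<tau>" by simp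
  have eq: "(\<integral>x. poly p x \<partial>\<nu>) = (\<integral>x. poly p x \<partial>\<tau>)" for p
    by (simp add: represents_integral_poly(2)[OF \<tau>] represents_integral_poly(2)[OF \<nu>])
  have AE\<tau>: "AE x in \<tau>. x \<in> closed_support \<tau>"
    by (rule AE_in_closed_support) (rule sets)
  define w where "w = (\<Prod>b\<in>closed_support \<tau>. [:-b, 1:])\<^sup>2"
  have w: "poly w x = 0 \<longleftrightarrow> x \<in> closed_support \<tau>" "poly w x \<ge> 0" for x
    using fin by (auto simp: w_def poly_prod)
  \<comment> \<open>The integral may be computed with \<open>\<tau>\<close>, for which \<open>w\<close> vanishes almost everywhere.\<close>
  have "(\<integral>x. poly w x \<partial>\<nu>) = 0"
    unfolding eq using AE\<tau> by (intro integral_eq_zero_AE) (auto simp: w)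
  then have AE\<nu>: "AE x in \<nu>. x \<in> closed_support \<tau>"
    using integral_nonneg_eq_0_iff_AE[OF represents_integral_poly(1)[OF \<nu>, of w]] w by simp
  fix A assume "A \<in> sets \<nu>"
  then have A: "A \<in> sets borel" "A \<in> sets \<tau>" "A \<in> sets \<nu>" using sets by auto
  obtain p :: "real poly" where p: "\<And>x. x \<in> closed_support \<tau> \<Longrightarrow> poly p x = indicator A x"
    using poly_interpolation[OF fin, of "indicator A"] by blast
  have meas: "measure \<theta> A = (\<integral>x. poly p x \<partial>\<theta>)"
    if "sets \<theta> = sets borel" "AE x in \<theta>. x \<in> closed_support \<tau>" for \<theta> :: "real measure"
  proof -
    have "space \<theta> = UNIV" using sets_eq_imp_space_eq[OF that(1)] by simp
    then have "measure \<theta> A = (\<integral>x. indicator A x \<partial>\<theta>)" by simp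
    also have "\<dots> = (\<integral>x. poly p x \<partial>\<theta>)"
      using that(2) p A that(1)
      by (intro integral_cong_AE)
        (auto simp: measurable_cong_sets[OF that(1) refl]
          intro!: borel_measurable_continuous_onI continuous_intros)
    finally show ?thesis .
  qed
  have "measure \<nu> A = measure \<tau> A"
    using meas[OF sets(1) AE\<tau>] meas[OF sets(2) AE\<nu>] eq by simp
  then show "emeasure \<nu> A = emeasure \<tau> A"
    using represents_finite_measure[OF \<tau>] represents_finite_measure[OF \<nu>]
    by (simp add: finite_measure.emeasure_eq_measure)
qed

lemma indeterminate_infinite_support:
  assumes "indeterminate t" "represents \<tau> t"
  shows "infinite (closed_support \<tau>)"
  using assms represents_unique_if_finite_support[OF assms(2)]
  by (auto simp: indeterminate_def determinate_def)

section \<open>Product measures and marginals\<close>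

lemma represents2_pair_measure:
  assumes \<mu>: "represents \<mu> s" and \<tau>: "represents \<tau> t"
  shows "represents2 (\<mu> \<Otimes>\<^sub>M \<tau>) (seq_tensor s t)"
proof -
  interpret \<mu>: finite_measure \<mu> using \<mu> by (rule represents_finite_measure)
  interpret \<tau>: finite_measure \<tau> using \<tau> by (rule represents_finite_measure)
  interpret pair_sigma_finite \<mu> \<tau> ..
  have sets: "sets (\<mu> \<Otimes>\<^sub>M \<tau>) = sets borel"
    using \<mu> \<tau> by (intro sets_pair_measure_borel) (simp_all add: represents_def)
  have int: "integrable \<mu> (\<lambda>x. x ^ n)" "(\<integral>x. x ^ n \<partial>\<mu>) = s n"
    "integrable \<tau> (\<lambda>x. x ^ n)" "(\<integral>x. x ^ n \<partial>\<tau>) = t n" for n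
    using \<mu> \<tau> by (auto simp: represents_def)
  have int2: "integrable (\<mu> \<Otimes>\<^sub>M \<tau>) (\<lambda>(x, y). x ^ m * y ^ n)" for m n
  proof (rule Fubini_integrable)
    show "(\<lambda>(x, y). x ^ m * y ^ n) \<in> borel_measurable (\<mu> \<Otimes>\<^sub>M \<tau>)"
      unfolding measurable_cong_sets[OF sets refl] case_prod_beta
      by (intro borel_measurable_continuous_onI continuous_intros)
    show "integrable \<mu> (\<lambda>x. \<integral>y. norm (case (x, y) of (x, y) \<Rightarrow> x ^ m * y ^ n) \<partial>\<tau>)"
      using int(1)[of m] by (auto simp: abs_mult)
    show "AE x in \<mu>. integrable \<tau> (\<lambda>y. case (x, y) of (x, y) \<Rightarrow> x ^ m * y ^ n)"
      using int(3)[of n] by auto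
  qed
  have "(\<integral>(x, y). x ^ m * y ^ n \<partial>(\<mu> \<Otimes>\<^sub>M \<tau>)) = s m * t n" for m n
    using integral_fst'[OF int2[of m n]] by (simp add: int)
  then show ?thesis
    using sets int2 by (auto simp: represents2_def seq_tensor_def)
qed

lemma borel_measurable_fst:
  fixes \<rho> :: "('a::topological_space \<times> 'b::topological_space) measure"
  assumes "sets \<rho> = sets borel"
  shows "fst \<in> borel_measurable \<rho>"
  unfolding measurable_cong_sets[OF assms refl]
  by (intro borel_measurable_continuous_onI continuous_intros)

text \<open>The marginal itself has the moments \<open>s m * t 0\<close>; the constant density removes the factor
  \<open>t 0\<close>, so that determinacy of \<open>s\<close> applies.\<close>

lemma represents_fst_marginal:
  assumes \<rho>: "represents2 \<rho> (seq_tensor s t)" and "t 0 > 0"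
  shows "represents (density (distr \<rho> borel fst) (\<lambda>_. ennreal (1 / t 0))) s"
proof -
  have [measurable]: "fst \<in> borel_measurable \<rho>"
    using \<rho> by (intro borel_measurable_fst) (simp add: represents2_def)
  have "integrable \<rho> (\<lambda>(x, y). x ^ n * y ^ 0)"
    "s n * t 0 = (\<integral>(x, y). x ^ n * y ^ 0 \<partial>\<rho>)" for n
    using \<rho> unfolding represents2_def seq_tensor_def by blast+
  then have "integrable \<rho> (\<lambda>z. fst z ^ n)" "(\<integral>z. fst z ^ n \<partial>\<rho>) = s n * t 0" for n
    by (simp_all add: case_prod_beta')
  then show ?thesis
    using \<open>t 0 > 0\<close>
    by (simp add: represents_def integrable_density integral_density integrable_distr_eq integral_distr)
qed

lemma pair_measure_cancel_left:
  assumes "finite_measure M" "sigma_finite_measure N" "sigma_finite_measure N'"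
    and "sets N' = sets N" "emeasure M (space M) \<noteq> 0" "M \<Otimes>\<^sub>M N = M \<Otimes>\<^sub>M N'"
  shows "N = N'"
proof (rule measure_eqI)
  fix A assume A: "A \<in> sets N"
  have "emeasure M (space M) * emeasure N A = emeasure (M \<Otimes>\<^sub>M N) (space M \<times> A)"
    using A by (simp add: sigma_finite_measure.emeasure_pair_measure_Times[OF assms(2)])
  also have "\<dots> = emeasure (M \<Otimes>\<^sub>M N') (space M \<times> A)"
    by (simp only: assms(6))
  also have "\<dots> = emeasure M (space M) * emeasure N' A"
    using A by (simp add: sigma_finite_measure.emeasure_pair_measure_Times[OF assms(3)] assms(4))
  finally show "emeasure N A = emeasure N' A"
    using assms by (simp add: ennreal_mult_cancel_left finite_measure.emeasure_finite)
qed (use assms in simp)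

section \<open>The tensor product\<close>

text \<open>Finiteness of the root set is used twice: for fixed \<open>y \<in> T\<close>, the polynomial \<open>q(\<cdot>, y)\<close> over \<open>\<complex>\<close>
  has infinitely many roots and is therefore \<open>0\<close>; this says that \<open>q\<close>, as a polynomial over the
  integral domain \<open>\<complex>[x]\<close>, has infinitely many constant roots.\<close>

lemma eval2_vanishing_on_infinite_product:
  fixes S T :: "real set"
  assumes "infinite S" "infinite T" and zero: "\<And>z. z \<in> S \<times> T \<Longrightarrow> eval2 q z = 0"
  shows "q = 0"
proof (rule ccontr)
  assume "q \<noteq> 0"
  have "poly q [:of_real y:] = 0" if "y \<in> T" for y
  proof (rule ccontr)
    assume "poly q [:of_real y:] \<noteq> 0"
    then have "finite {c. poly (poly q [:of_real y:]) c = 0}" by (rule poly_roots_finite)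
    moreover have "of_real ` S \<subseteq> {c. poly (poly q [:of_real y:]) c = 0}"
      using zero that by (auto simp: eval2_def)
    ultimately show False
      using \<open>infinite S\<close> by (meson finite_imageD finite_subset inj_on_def of_real_eq_iff)
  qed
  then have "(\<lambda>y. [:of_real y:]) ` T \<subseteq> {c. poly q c = 0}" by auto
  moreover have "finite {c. poly q c = 0}" using \<open>q \<noteq> 0\<close> by (rule poly_roots_finite)
  moreover have "inj_on (\<lambda>y. [:complex_of_real y:]) T" by (auto simp: inj_on_def)
  ultimately show False
    using \<open>infinite T\<close> by (meson finite_imageD finite_subset)
qed

lemma continuous_on_eval2: "continuous_on A (eval2 q)"
proof -
  have "eval2 q = (\<lambda>z. \<Sum>j\<le>degree q. \<Sum>i\<le>degree (coeff q j).
      coeff (coeff q j) i * of_real (fst z ^ i * snd z ^ j))"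
    by (auto simp: fun_eq_iff eval2_altdef simp del: of_real_mult of_real_power)
  then show ?thesis by (simp only:) (intro continuous_intros)
qed

lemma eval2_eq_0_on_closed_support:
  assumes sets: "sets \<rho> = sets borel" and AE: "AE z in \<rho>. eval2 q z = 0" and "z \<in> closed_support \<rho>"
  shows "eval2 q z = 0"
proof (rule ccontr)
  assume "eval2 q z \<noteq> 0"
  let ?U = "{z. eval2 q z \<noteq> 0}"
  have "open ?U"
    by (intro open_Collect_neq continuous_on_eval2 continuous_on_const)
  moreover have "emeasure \<rho> {z \<in> space \<rho>. eval2 q z \<noteq> 0} = 0"
    using AE by (intro emeasure_eq_0_AE) simp
  then have "emeasure \<rho> ?U = 0"
    using sets_eq_imp_space_eq[OF sets] by simp
  ultimately show False
    using assms(3) \<open>eval2 q z \<noteq> 0\<close> by (auto simp: closed_support_def)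
qed

lemma zariski_dense_support:
  assumes \<mu>: "represents \<mu> s" "infinite (closed_support \<mu>)"
    and \<tau>: "represents \<tau> t" "infinite (closed_support \<tau>)"
    and \<rho>: "represents2 \<rho> (seq_tensor s t)"
  shows "zariski closure_of (closed_support \<rho>) = UNIV"
proof -
  let ?C = "zariski closure_of (closed_support \<rho>)"
  obtain q where q: "?C = zero_locus q"
    using closedin_closure_of closedin_zariski by metis
  have "closed_support \<rho> \<subseteq> zero_locus q"
    unfolding q[symmetric] by (rule closure_of_subset) (simp add: topspace_zariski)
  moreover have "sets \<rho> = sets borel" using \<rho> by (simp add: represents2_def)
  ultimately have "AE z in \<rho>. eval2 q z = 0"
    using AE_in_closed_support[of \<rho>] by (auto simp: zero_locus_def elim!: AE_mp)
  then have AE: "AE z in \<mu> \<Otimes>\<^sub>M \<tau>. eval2 q z = 0"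
    using represents2_AE_eval2_eq_0_cong[OF \<rho> represents2_pair_measure[OF \<mu>(1) \<tau>(1)]] by blast
  interpret \<tau>: finite_measure \<tau> using \<tau>(1) by (rule represents_finite_measure)
  have "eval2 q z = 0" if "z \<in> closed_support \<mu> \<times> closed_support \<tau>" for z
  proof (rule eval2_eq_0_on_closed_support[OF _ AE])
    show "sets (\<mu> \<Otimes>\<^sub>M \<tau>) = sets borel"
      using represents2_pair_measure[OF \<mu>(1) \<tau>(1)] by (simp add: represents2_def)
    show "z \<in> closed_support (\<mu> \<Otimes>\<^sub>M \<tau>)"
      using closed_support_times_subset[of \<mu> \<tau>] that \<mu>(1) \<tau>(1) \<tau>.sigma_finite_measure_axioms
      by (auto simp: represents_def)
  qed
  then have "q = 0"
    using eval2_vanishing_on_infinite_product[OF \<mu>(2) \<tau>(2)] by blast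
  then show ?thesis by (simp add: q zero_locus_def eval2_simps)
qed

lemma represents_mass_pos:
  assumes \<tau>: "represents \<tau> t" and "infinite (closed_support \<tau>)"
  shows "emeasure \<tau> (space \<tau>) \<noteq> 0" "t 0 > 0"
proof -
  interpret finite_measure \<tau> using \<tau> by (rule represents_finite_measure)
  have space: "space \<tau> = UNIV"
    using \<tau> sets_eq_imp_space_eq[of \<tau> borel] by (simp add: represents_def)
  obtain x where "x \<in> closed_support \<tau>" using assms(2) by fastforce
  then show pos: "emeasure \<tau> (space \<tau>) \<noteq> 0"
    by (auto simp: space closed_support_def dest!: spec[of _ UNIV])
  have "t 0 = measure \<tau> (space \<tau>)" using \<tau> by (simp add: represents_def)
  with pos show "t 0 > 0" by (simp add: emeasure_eq_measure zero_less_measure_iff)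
qed

theorem theorem15:
  fixes s t :: "nat \<Rightarrow> real" and \<mu> :: "real measure"
  assumes "determinate s"
    and "represents \<mu> s"
    and "infinite (closed_support \<mu>)"
    and "emeasure \<mu> {0} = 0"
    and "indeterminate t"
  shows "hamburger2 (seq_tensor s t) \<and>
    indeterminate2 (seq_tensor s t) \<and>
    (\<forall>\<rho>. represents2 \<rho> (seq_tensor s t) \<longrightarrow> emeasure \<rho> {(0, 0)} = 0) \<and>
    (\<forall>\<rho>. represents2 \<rho> (seq_tensor s t) \<longrightarrow>
      zariski closure_of (closed_support \<rho>) = UNIV)"
proof (intro conjI allI impI)
  obtain \<tau> \<tau>' where \<tau>: "represents \<tau> t" "represents \<tau>' t" "\<tau> \<noteq> \<tau>'"
    using assms(5) by (auto simp: indeterminate_def hamburger_def determinate_def)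
  have inf: "infinite (closed_support \<tau>)"
    using assms(5) \<tau>(1) by (rule indeterminate_infinite_support)
  show ham: "hamburger2 (seq_tensor s t)"
    using represents2_pair_measure[OF assms(2) \<tau>(1)] by (auto simp: hamburger2_def)
  have "\<mu> \<Otimes>\<^sub>M \<tau> \<noteq> \<mu> \<Otimes>\<^sub>M \<tau>'"
  proof
    assume eq: "\<mu> \<Otimes>\<^sub>M \<tau> = \<mu> \<Otimes>\<^sub>M \<tau>'"
    have "\<tau> = \<tau>'"
    proof (rule pair_measure_cancel_left[OF _ _ _ _ _ eq])
      show "sigma_finite_measure \<tau>" "sigma_finite_measure \<tau>'"
        using represents_finite_measure \<tau>(1,2) by (blast intro: finite_measure.axioms(1))+
      show "sets \<tau>' = sets \<tau>" using \<tau>(1,2) by (simp add: represents_def)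
    qed (rule represents_finite_measure[OF assms(2)] represents_mass_pos(1)[OF assms(2,3)])+
    with \<tau>(3) show False ..
  qed
  then show "indeterminate2 (seq_tensor s t)"
    using ham represents2_pair_measure[OF assms(2) \<tau>(1)] represents2_pair_measure[OF assms(2) \<tau>(2)]
    by (auto simp: indeterminate2_def determinate2_def)
  fix \<rho> assume \<rho>: "represents2 \<rho> (seq_tensor s t)"
  show "zariski closure_of (closed_support \<rho>) = UNIV"
    using assms(2,3) \<tau>(1) inf \<rho> by (rule zariski_dense_support)
  define \<nu> where "\<nu> = distr \<rho> borel fst"
  have pos: "t 0 > 0" using \<tau>(1) inf by (rule represents_mass_pos)
  have "density \<nu> (\<lambda>_. ennreal (1 / t 0)) = \<mu>"
    using assms(1,2) represents_fst_marginal[OF \<rho> pos] by (auto simp: determinate_def \<nu>_def)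
  then have "ennreal (1 / t 0) * emeasure \<nu> {0} = 0"
    using assms(4) emeasure_density_const[of "{0}" \<nu> "ennreal (1 / t 0)"] by (simp add: \<nu>_def)
  then have 0: "emeasure \<nu> {0} = 0" using pos by simp
  have sets: "sets \<rho> = sets borel" "space \<rho> = UNIV"
    using \<rho> sets_eq_imp_space_eq[of \<rho> borel] by (auto simp: represents2_def)
  have fst: "fst \<in> borel_measurable \<rho>"
    using sets(1) by (rule borel_measurable_fst)
  \<comment> \<open>The marginal charges \<open>0\<close> at least as much as \<open>\<rho>\<close> charges the origin.\<close>
  have "emeasure \<rho> {(0, 0)} \<le> emeasure \<rho> (fst -` {0} \<inter> space \<rho>)"
    by (intro emeasure_mono measurable_sets[OF fst]) (auto simp: sets)
  also have "\<dots> = 0"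
    using 0 fst by (simp add: \<nu>_def emeasure_distr)
  finally show "emeasure \<rho> {(0, 0)} = 0" by simp
qed

end
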